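(* Let $\Omega\subset\mathbb{R}^3$ be a bounded sliceable domain with Lipschitz boundary $\Gamma$, and let $\emptyset\neq\Gamma_t\subset\Gamma$ be relatively open and separated from $\Gamma_n:=\Gamma\setminus\overline{\Gamma_t}$ by a Lipschitz curve. Let $c_m>0$ be a Maxwell constant and $c_k>0$ an irrotational Korn constant for $(\Omega,\Gamma_t)$ (defined in the context) and $\hat c:=\max\{\sqrt2\,c_k,\;c_m\sqrt{1+2c_k^2}\}$. Then: (i) $\|T\|_{L^2(\Omega)}\leq\hat c\,\|\mathrm{sym}\,T\|_{L^2(\Omega)}$ holds for all tensor fields $T\in\mathring H(\mathrm{Curl}_0;\Gamma_t,\Omega)$. (ii) $\|\mathrm{Grad}\,v\|_{L^2(\Omega)}\leq\hat c\,\|\mathrm{sym}\,\mathrm{Grad}\,v\|_{L^2(\Omega)}$ holds for all vector fields $v\in H(\mathrm{Grad};\Omega)$ with $\mathrm{Grad}\,v\in\mathring H(\mathrm{Curl}_0;\Gamma_t,\Omega)$. (iii) $\|\mathrm{Grad}\,v\|_{L^2(\Omega)}\leq\hat c\,\|\mathrm{sym}\,\mathrm{Grad}\,v\|_{L^2(\Omega)}$ holds for all vector fields $v\in\mathring H(\mathrm{Grad};\Gamma_t,\Omega)$.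
   Context: A domain is a nonempty connected open set. $L^2(\Omega)$ denotes square-integrable functions, vector fields or $3\times3$ tensor fields (with the Frobenius inner product), $\bot$ is the orthogonal complement in $L^2(\Omega)$. $\mathrm{sym}\,T=\frac12(T+T^\top)$. "$\Gamma_t$ and $\Gamma_n$ are separated by a Lipschitz curve" means that the common relative boundary of $\Gamma_t$ and $\Gamma_n$ in $\Gamma$ is empty or is, locally in bi-Lipschitz charts of $\Gamma$, a Lipschitz curve with $\Gamma_t$ on one side and $\Gamma_n$ on the other. For $\gamma\subset\Gamma$, $\mathring C^\infty(\gamma,\Omega):=\{u\in C^\infty(\overline\Omega):\mathrm{dist}(\mathrm{supp}\,u,\gamma)>0\}$ (all of $C^\infty(\overline\Omega)$ if $\gamma=\emptyset$). $\mathring H(\mathrm{curl};\Gamma_t,\Omega)$ and $\mathring H(\mathrm{div};\Gamma_n,\Omega)$ are the closures of the vector fields with components in $\mathring C^\infty(\Gamma_t,\Omega)$ resp. $\mathring C^\infty(\Gamma_n,\Omega)$ in the graph norms of $\mathrm{curl}$ resp. $\mathrm{div}$ in $L^2$. A lower index $0$ (as in $\mathrm{curl}_0$, $\mathrm{div}_0$) means additionally $\mathrm{curl}\,v=0$ resp. $\mathrm{div}\,v=0$. $\mathcal H(\Omega):=\mathring H(\mathrm{curl}_0;\Gamma_t,\Omega)\cap\mathring H(\mathrm{div}_0;\Gamma_n,\Omega)$. $\mathrm{Grad}\,v$ is the Jacobian of a vector field $v$ (rows are gradients of the components). $H(\mathrm{Grad};\Omega)=H^1(\Omega,\mathbb R^3)$,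 and $\mathring H(\mathrm{Grad};\Gamma_t,\Omega)$ is the closure in it of the vector fields with components in $\mathring C^\infty(\Gamma_t,\Omega)$. $\mathring H(\mathrm{Curl}_0;\Gamma_t,\Omega)$ is the space of $3\times3$ tensor fields all of whose rows lie in $\mathring H(\mathrm{curl}_0;\Gamma_t,\Omega)$. Sliceable: $\Omega$ is sliceable (with respect to $\Gamma_t\neq\emptyset$) if there exist $J\in\mathbb N$ and $\Omega_j\subset\Omega$, $j=1,\dots,J$, such that $\Omega\setminus(\Omega_1\cup\dots\cup\Omega_J)$ is a null set and, for each $j$: the $\Omega_j$ are open, pairwise disjoint, simply connected Lipschitz subdomains of $\Omega$, and $\mathrm{int}_{\mathrm{rel}}(\overline{\Omega_j}\cap\Gamma_t)\neq\emptyset$ (interior relative to $\Gamma$). Maxwell constant $c_m>0$: $\|v\|_{L^2}\leq c_m(\|\mathrm{curl}\,v\|_{L^2}^2+\|\mathrm{div}\,v\|_{L^2}^2)^{1/2}$ for all $v\in\mathring H(\mathrm{curl};\Gamma_t,\Omega)\cap\mathring H(\mathrm{div};\Gamma_n,\Omega)\cap\mathcal H(\Omega)^\bot$. Irrotational Korn constant $c_k>0$: $\|T\|_{L^2}\leq c_k\|\mathrm{sym}\,T\|_{L^2}$ for all $T\in\mathring H(\mathrm{Curl}_0;\Gamma_t,\Omega)$. Such constants exist under the stated assumptions. *)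

theory Defs
  imports "HOL-Analysis.Analysis"
begin

subsection \<open>Smooth functions and classical differential operators\<close>

definition partial :: "3 \<Rightarrow> (real^3 \<Rightarrow> real) \<Rightarrow> real^3 \<Rightarrow> real" where
  "partial i f x = frechet_derivative f (at x) (axis i 1)"

primrec C_k :: "nat \<Rightarrow> (real^3 \<Rightarrow> real) \<Rightarrow> bool" where
  "C_k 0 f \<longleftrightarrow> continuous_on UNIV f"
| "C_k (Suc k) f \<longleftrightarrow> (\<forall>x. f differentiable (at x)) \<and> (\<forall>i. C_k k (partial i f))"

definition smooth :: "(real^3 \<Rightarrow> real) \<Rightarrow> bool" where
  "smooth f \<longleftrightarrow> (\<forall>k. C_k k f)"

definition gradient :: "(real^3 \<Rightarrow> real) \<Rightarrow> real^3 \<Rightarrow> real^3" where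
  "gradient f x = (\<chi> j. partial j f x)"

definition Jacobian :: "(real^3 \<Rightarrow> real^3) \<Rightarrow> real^3 \<Rightarrow> real^3^3" where
  "Jacobian v x = (\<chi> i. gradient (\<lambda>y. v y $ i) x)"

definition divergence :: "(real^3 \<Rightarrow> real^3) \<Rightarrow> real^3 \<Rightarrow> real" where
  "divergence v x = (\<Sum>i\<in>UNIV. partial i (\<lambda>y. v y $ i) x)"

definition curl :: "(real^3 \<Rightarrow> real^3) \<Rightarrow> real^3 \<Rightarrow> real^3" where
  "curl v x = vector
     [partial 2 (\<lambda>y. v y $ 3) x - partial 3 (\<lambda>y. v y $ 2) x,
      partial 3 (\<lambda>y. v y $ 1) x - partial 1 (\<lambda>y. v y $ 3) x,
      partial 1 (\<lambda>y. v y $ 2) x - partial 2 (\<lambda>y. v y $ 1) x]"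

definition sym_part :: "real^3^3 \<Rightarrow> real^3^3" where
  "sym_part T = (1/2) *\<^sub>R (T + transpose T)"

definition test_functions :: "(real^3) set \<Rightarrow> (real^3 \<Rightarrow> real) set" where
  "test_functions \<Omega> =
     {\<phi>. smooth \<phi> \<and> compact (closure {x. \<phi> x \<noteq> 0}) \<and> closure {x. \<phi> x \<noteq> 0} \<subseteq> \<Omega>}"

definition test_fields :: "(real^3) set \<Rightarrow> (real^3 \<Rightarrow> real^3) set" where
  "test_fields \<Omega> = {\<phi>. \<forall>i. (\<lambda>x. \<phi> x $ i) \<in> test_functions \<Omega>}"

text \<open>
  Elements of \<open>C\<^sup>\<infinity>\<close> on the closure of \<open>\<Omega>\<close> are represented by smooth extensions to the whole
  space. The condition that the support has positive distance to \<open>\<gamma>\<close> is written out, since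
  \<^const>\<open>setdist\<close> is \<open>0\<close> (instead of \<open>\<infinity>\<close>) if one of the sets is empty.
\<close>

definition smooth_away :: "(real^3) set \<Rightarrow> (real^3) set \<Rightarrow> (real^3 \<Rightarrow> real) set" where
  "smooth_away \<gamma> \<Omega> =
     {u. smooth u \<and>
         (\<exists>\<delta>>0. \<forall>x \<in> closure {x \<in> closure \<Omega>. u x \<noteq> 0}. \<forall>y\<in>\<gamma>. \<delta> \<le> dist x y)}"

definition smooth_fields_away :: "(real^3) set \<Rightarrow> (real^3) set \<Rightarrow> (real^3 \<Rightarrow> real^3) set" where
  "smooth_fields_away \<gamma> \<Omega> = {u. \<forall>i. (\<lambda>x. u x $ i) \<in> smooth_away \<gamma> \<Omega>}"

subsection \<open>Square-integrable fields and weak derivatives\<close>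

text \<open>
  Elements of \<open>L\<^sup>2\<close> are represented by functions, not by equivalence classes; all notions below
  are invariant under modification on null sets. On \<^typ>\<open>real^3^3\<close>, the library's inner product
  and norm are the Frobenius ones.
\<close>

definition L2 :: "(real^3) set \<Rightarrow> (real^3 \<Rightarrow> 'b::euclidean_space) set" where
  "L2 \<Omega> = {f. f \<in> borel_measurable (lebesgue_on \<Omega>) \<and>
              integrable (lebesgue_on \<Omega>) (\<lambda>x. (norm (f x))\<^sup>2)}"

definition L2_norm :: "(real^3) set \<Rightarrow> (real^3 \<Rightarrow> 'b::euclidean_space) \<Rightarrow> real" where
  "L2_norm \<Omega> f = sqrt (\<integral>x. (norm (f x))\<^sup>2 \<partial>(lebesgue_on \<Omega>))"

definition L2_inner ::
    "(real^3) set \<Rightarrow> (real^3 \<Rightarrow> 'b::euclidean_space) \<Rightarrow> (real^3 \<Rightarrow> 'b) \<Rightarrow> real" where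
  "L2_inner \<Omega> f g = (\<integral>x. f x \<bullet> g x \<partial>(lebesgue_on \<Omega>))"

definition orth_compl ::
    "(real^3) set \<Rightarrow> (real^3 \<Rightarrow> 'b::euclidean_space) set \<Rightarrow> (real^3 \<Rightarrow> 'b) set" where
  "orth_compl \<Omega> H = {v \<in> L2 \<Omega>. \<forall>h\<in>H. L2_inner \<Omega> v h = 0}"

text \<open>
  Each of the next three relations says that the first field and its weak derivative (the
  second field, unique up to null sets) both lie in \<open>L\<^sup>2\<close>.
\<close>

definition has_weak_curl ::
    "(real^3) set \<Rightarrow> (real^3 \<Rightarrow> real^3) \<Rightarrow> (real^3 \<Rightarrow> real^3) \<Rightarrow> bool" where
  "has_weak_curl \<Omega> v w \<longleftrightarrow> v \<in> L2 \<Omega> \<and> w \<in> L2 \<Omega> \<and>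
     (\<forall>\<phi> \<in> test_fields \<Omega>. L2_inner \<Omega> v (curl \<phi>) = L2_inner \<Omega> w \<phi>)"

definition has_weak_div ::
    "(real^3) set \<Rightarrow> (real^3 \<Rightarrow> real^3) \<Rightarrow> (real^3 \<Rightarrow> real) \<Rightarrow> bool" where
  "has_weak_div \<Omega> v d \<longleftrightarrow> v \<in> L2 \<Omega> \<and> d \<in> L2 \<Omega> \<and>
     (\<forall>\<phi> \<in> test_functions \<Omega>. L2_inner \<Omega> v (gradient \<phi>) = - L2_inner \<Omega> d \<phi>)"

definition has_weak_Grad ::
    "(real^3) set \<Rightarrow> (real^3 \<Rightarrow> real^3) \<Rightarrow> (real^3 \<Rightarrow> real^3^3) \<Rightarrow> bool" where
  "has_weak_Grad \<Omega> v G \<longleftrightarrow> v \<in> L2 \<Omega> \<and> G \<in> L2 \<Omega> \<and>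
     (\<forall>\<phi> \<in> test_functions \<Omega>. \<forall>i j.
        L2_inner \<Omega> (\<lambda>x. v x $ i) (partial j \<phi>) = - L2_inner \<Omega> (\<lambda>x. G x $ i $ j) \<phi>)"

definition H_Grad :: "(real^3) set \<Rightarrow> (real^3 \<Rightarrow> real^3) set" where
  "H_Grad \<Omega> = {v. \<exists>G. has_weak_Grad \<Omega> v G}"

definition Grad :: "(real^3) set \<Rightarrow> (real^3 \<Rightarrow> real^3) \<Rightarrow> real^3 \<Rightarrow> real^3^3" where
  "Grad \<Omega> v = (SOME G. has_weak_Grad \<Omega> v G)"

subsection \<open>Spaces with partial boundary conditions\<close>

definition H_curl_bc :: "(real^3) set \<Rightarrow> (real^3) set \<Rightarrow> (real^3 \<Rightarrow> real^3) set" where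
  "H_curl_bc \<gamma> \<Omega> = {v. \<exists>w. has_weak_curl \<Omega> v w \<and>
     (\<forall>\<epsilon>>0. \<exists>\<phi> \<in> smooth_fields_away \<gamma> \<Omega>.
        sqrt ((L2_norm \<Omega> (\<lambda>x. v x - \<phi> x))\<^sup>2 + (L2_norm \<Omega> (\<lambda>x. w x - curl \<phi> x))\<^sup>2) < \<epsilon>)}"

definition H_div_bc :: "(real^3) set \<Rightarrow> (real^3) set \<Rightarrow> (real^3 \<Rightarrow> real^3) set" where
  "H_div_bc \<gamma> \<Omega> = {v. \<exists>d. has_weak_div \<Omega> v d \<and>
     (\<forall>\<epsilon>>0. \<exists>\<phi> \<in> smooth_fields_away \<gamma> \<Omega>.
        sqrt ((L2_norm \<Omega> (\<lambda>x. v x - \<phi> x))\<^sup>2 + (L2_norm \<Omega> (\<lambda>x. d x - divergence \<phi> x))\<^sup>2) < \<epsilon>)}"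

definition H_Grad_bc :: "(real^3) set \<Rightarrow> (real^3) set \<Rightarrow> (real^3 \<Rightarrow> real^3) set" where
  "H_Grad_bc \<gamma> \<Omega> = {v \<in> H_Grad \<Omega>.
     \<forall>\<epsilon>>0. \<exists>\<phi> \<in> smooth_fields_away \<gamma> \<Omega>.
        sqrt ((L2_norm \<Omega> (\<lambda>x. v x - \<phi> x))\<^sup>2 + (L2_norm \<Omega> (\<lambda>x. Grad \<Omega> v x - Jacobian \<phi> x))\<^sup>2) < \<epsilon>}"

definition H_curl0_bc :: "(real^3) set \<Rightarrow> (real^3) set \<Rightarrow> (real^3 \<Rightarrow> real^3) set" where
  "H_curl0_bc \<gamma> \<Omega> = {v \<in> H_curl_bc \<gamma> \<Omega>. has_weak_curl \<Omega> v (\<lambda>x. 0)}"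

definition H_div0_bc :: "(real^3) set \<Rightarrow> (real^3) set \<Rightarrow> (real^3 \<Rightarrow> real^3) set" where
  "H_div0_bc \<gamma> \<Omega> = {v \<in> H_div_bc \<gamma> \<Omega>. has_weak_div \<Omega> v (\<lambda>x. 0)}"

definition H_Curl0_bc :: "(real^3) set \<Rightarrow> (real^3) set \<Rightarrow> (real^3 \<Rightarrow> real^3^3) set" where
  "H_Curl0_bc \<gamma> \<Omega> = {T. \<forall>i. (\<lambda>x. T x $ i) \<in> H_curl0_bc \<gamma> \<Omega>}"

definition harmonic_fields ::
    "(real^3) set \<Rightarrow> (real^3) set \<Rightarrow> (real^3) set \<Rightarrow> (real^3 \<Rightarrow> real^3) set" where
  "harmonic_fields \<Gamma>\<^sub>t \<Gamma>\<^sub>n \<Omega> = H_curl0_bc \<Gamma>\<^sub>t \<Omega> \<inter> H_div0_bc \<Gamma>\<^sub>n \<Omega>"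

definition maxwell_constant ::
    "(real^3) set \<Rightarrow> (real^3) set \<Rightarrow> (real^3) set \<Rightarrow> real \<Rightarrow> bool" where
  "maxwell_constant \<Gamma>\<^sub>t \<Gamma>\<^sub>n \<Omega> c \<longleftrightarrow> c > 0 \<and>
     (\<forall>v \<in> H_curl_bc \<Gamma>\<^sub>t \<Omega> \<inter> H_div_bc \<Gamma>\<^sub>n \<Omega> \<inter> orth_compl \<Omega> (harmonic_fields \<Gamma>\<^sub>t \<Gamma>\<^sub>n \<Omega>).
      \<forall>w d. has_weak_curl \<Omega> v w \<longrightarrow> has_weak_div \<Omega> v d \<longrightarrow>
        L2_norm \<Omega> v \<le> c * sqrt ((L2_norm \<Omega> w)\<^sup>2 + (L2_norm \<Omega> d)\<^sup>2))"

definition irrotational_korn_constant ::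
    "(real^3) set \<Rightarrow> (real^3) set \<Rightarrow> real \<Rightarrow> bool" where
  "irrotational_korn_constant \<Gamma>\<^sub>t \<Omega> c \<longleftrightarrow> c > 0 \<and>
     (\<forall>T \<in> H_Curl0_bc \<Gamma>\<^sub>t \<Omega>. L2_norm \<Omega> T \<le> c * L2_norm \<Omega> (\<lambda>x. sym_part (T x)))"

subsection \<open>Geometry of the domain and its boundary\<close>

definition is_domain :: "(real^3) set \<Rightarrow> bool" where
  "is_domain \<Omega> \<longleftrightarrow> open \<Omega> \<and> connected \<Omega> \<and> \<Omega> \<noteq> {}"

text \<open>
  Near each boundary point the set is, in suitable Cartesian coordinates, the strict epigraph of
  a Lipschitz function.
\<close>

definition lipschitz_boundary :: "(real^3) set \<Rightarrow> bool" where
  "lipschitz_boundary \<Omega> \<longleftrightarrow>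
     (\<forall>p \<in> frontier \<Omega>. \<exists>r>0. \<exists>(R :: real^3 \<Rightarrow> real^3) (g :: real \<times> real \<Rightarrow> real) L.
        orthogonal_transformation R \<and> L-lipschitz_on UNIV g \<and>
        \<Omega> \<inter> ball p r = {x \<in> ball p r. g (R x $ 1, R x $ 2) < R x $ 3})"

definition bilipschitz_chart ::
    "(real^3) set \<Rightarrow> (real^3) set \<Rightarrow> (real \<times> real) set \<Rightarrow> (real^3 \<Rightarrow> real \<times> real) \<Rightarrow> bool" where
  "bilipschitz_chart \<Gamma> U V \<Phi> \<longleftrightarrow>
     openin (top_of_set \<Gamma>) U \<and> open V \<and> bij_betw \<Phi> U V \<and>
     (\<exists>L. L-lipschitz_on U \<Phi>) \<and> (\<exists>L. L-lipschitz_on V (inv_into U \<Phi>))"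

definition separated_by_lipschitz_curve ::
    "(real^3) set \<Rightarrow> (real^3) set \<Rightarrow> (real^3) set \<Rightarrow> bool" where
  "separated_by_lipschitz_curve \<Gamma> \<Gamma>\<^sub>t \<Gamma>\<^sub>n \<longleftrightarrow>
     (let S = (top_of_set \<Gamma> frontier_of \<Gamma>\<^sub>t) \<inter> (top_of_set \<Gamma> frontier_of \<Gamma>\<^sub>n) in
      \<forall>p\<in>S. \<exists>U V \<Phi> (g :: real \<Rightarrow> real) L.
        p \<in> U \<and> bilipschitz_chart \<Gamma> U V \<Phi> \<and> L-lipschitz_on UNIV g \<and>
        \<Phi> ` (U \<inter> S) = {(s, t) \<in> V. t = g s} \<and>
        \<Phi> ` (U \<inter> \<Gamma>\<^sub>t) = {(s, t) \<in> V. g s < t} \<and>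
        \<Phi> ` (U \<inter> \<Gamma>\<^sub>n) = {(s, t) \<in> V. t < g s})"

definition sliceable :: "(real^3) set \<Rightarrow> (real^3) set \<Rightarrow> bool" where
  "sliceable \<Gamma>\<^sub>t \<Omega> \<longleftrightarrow>
     (\<exists>(J::nat) (\<Omega>' :: nat \<Rightarrow> (real^3) set).
        (\<Omega> - (\<Union>j\<in>{1..J}. \<Omega>' j)) \<in> null_sets lebesgue \<and>
        disjoint_family_on \<Omega>' {1..J} \<and>
        (\<forall>j\<in>{1..J}. \<Omega>' j \<subseteq> \<Omega> \<and> is_domain (\<Omega>' j) \<and> simply_connected (\<Omega>' j) \<and>
           lipschitz_boundary (\<Omega>' j) \<and>
           top_of_set (frontier \<Omega>) interior_of (closure (\<Omega>' j) \<inter> \<Gamma>\<^sub>t) \<noteq> {}))"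

end

theory Submission
  imports Defs
begin

text \<open>
  Since \<open>c\<^sub>k \<le> \<surd>2 c\<^sub>k \<le> c_hat\<close>, the larger number \<open>c_hat\<close> is an irrotational Korn constant as well,
  which gives (i) and (ii). For (iii), the Jacobian of a field in the \<open>H\<^sup>1\<close>-closure of the fields
  vanishing near \<open>\<Gamma>\<^sub>t\<close> is a tensor field to which (i) applies: its rows are \<open>L\<^sup>2\<close>-limits of
  gradients of smooth functions vanishing near \<open>\<Gamma>\<^sub>t\<close>, those gradients are curl free and again vanish
  near \<open>\<Gamma>\<^sub>t\<close>, and testing the weak gradient with the first partial derivatives of a test field
  shows that the rows are weakly curl free. Both vanishing curls come from the symmetry of second
  derivatives.
\<close>

definition has_directional_derivative :: "('a::real_vector \<Rightarrow> real) \<Rightarrow> real \<Rightarrow> 'a \<Rightarrow> 'a \<Rightarrow> bool" where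
  "has_directional_derivative f d u x \<longleftrightarrow> ((\<lambda>s. f (x + s *\<^sub>R u)) has_real_derivative d) (at 0)"

lemma has_directional_derivative_along_line:
  assumes "has_directional_derivative f d u (x + s *\<^sub>R u)"
  shows "((\<lambda>r. f (x + r *\<^sub>R u)) has_real_derivative d) (at s)"
  using assms DERIV_shift[of "\<lambda>r. f (x + r *\<^sub>R u)" d 0 s]
  by (simp add: has_directional_derivative_def algebra_simps)

definition second_difference :: "('a::real_vector \<Rightarrow> real) \<Rightarrow> 'a \<Rightarrow> 'a \<Rightarrow> 'a \<Rightarrow> real" where
  "second_difference f u v x = f (x + u + v) - f (x + u) - f (x + v) + f x"

lemma second_difference_commute: "second_difference f u v x = second_difference f v u x"
  by (simp add: second_difference_def ac_simps)

definition parallelogram :: "real \<Rightarrow> 'a::real_vector \<Rightarrow> 'a \<Rightarrow> 'a \<Rightarrow> 'a set" where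
  "parallelogram h u v x = {x + s *\<^sub>R u + t *\<^sub>R v |s t. s \<in> {0..h} \<and> t \<in> {0..h}}"

lemma dist_parallelogram_le:
  assumes "y \<in> parallelogram h u v x"
  shows "dist y x \<le> h * (norm u + norm v)"
proof -
  obtain s t where st: "y = x + s *\<^sub>R u + t *\<^sub>R v" "s \<in> {0..h}" "t \<in> {0..h}"
    using assms by (auto simp: parallelogram_def)
  then have "dist y x \<le> s * norm u + t * norm v"
    using norm_triangle_ineq[of "s *\<^sub>R u" "t *\<^sub>R v"] by (simp add: dist_norm add.assoc)
  also have "\<dots> \<le> h * (norm u + norm v)"
    using st by (auto simp: distrib_left intro!: add_mono mult_right_mono)
  finally show ?thesis .
qed

lemma second_difference_mean_value:
  fixes f f\<^sub>u f\<^sub>u\<^sub>v :: "'a::real_vector \<Rightarrow> real"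
  assumes "0 < h"
    and f\<^sub>u: "\<And>y. y \<in> parallelogram h u v x \<Longrightarrow> has_directional_derivative f (f\<^sub>u y) u y"
    and f\<^sub>u\<^sub>v: "\<And>y. y \<in> parallelogram h u v x \<Longrightarrow> has_directional_derivative f\<^sub>u (f\<^sub>u\<^sub>v y) v y"
  shows "\<exists>y \<in> parallelogram h u v x.
    second_difference f (h *\<^sub>R u) (h *\<^sub>R v) x = h\<^sup>2 * f\<^sub>u\<^sub>v y"
proof -
  have in_parallelogram: "x + s *\<^sub>R u + t *\<^sub>R v \<in> parallelogram h u v x"
    if "0 \<le> s" "s \<le> h" "0 \<le> t" "t \<le> h" for s t
    using that by (auto simp: parallelogram_def)
  let ?g = "\<lambda>s. f (x + h *\<^sub>R v + s *\<^sub>R u) - f (x + s *\<^sub>R u)"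
  let ?g' = "\<lambda>s. f\<^sub>u (x + h *\<^sub>R v + s *\<^sub>R u) - f\<^sub>u (x + s *\<^sub>R u)"
  have "DERIV ?g s :> ?g' s" if "0 \<le> s" "s \<le> h" for s
    using in_parallelogram[of s h] in_parallelogram[of s 0] that \<open>0 < h\<close>
    by (intro DERIV_diff has_directional_derivative_along_line f\<^sub>u) (simp_all add: ac_simps)
  then obtain s where s: "0 < s" "s < h" "?g h - ?g 0 = (h - 0) * ?g' s"
    using MVT2[OF \<open>0 < h\<close>, of ?g ?g'] by blast
  let ?k = "\<lambda>t. f\<^sub>u (x + s *\<^sub>R u + t *\<^sub>R v)"
  let ?k' = "\<lambda>t. f\<^sub>u\<^sub>v (x + s *\<^sub>R u + t *\<^sub>R v)"
  have "DERIV ?k t :> ?k' t" if "0 \<le> t" "t \<le> h" for t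
    using in_parallelogram[of s t] that s
    by (intro has_directional_derivative_along_line f\<^sub>u\<^sub>v) simp
  then obtain t where t: "0 < t" "t < h" "?k h - ?k 0 = (h - 0) * ?k' t"
    using MVT2[OF \<open>0 < h\<close>, of ?k ?k'] by blast
  have "second_difference f (h *\<^sub>R u) (h *\<^sub>R v) x = ?g h - ?g 0"
    by (simp add: second_difference_def ac_simps)
  also have "\<dots> = h * ?g' s"
    using s by simp
  also have "?g' s = ?k h - ?k 0"
    by (simp add: ac_simps)
  also have "h * (?k h - ?k 0) = h\<^sup>2 * ?k' t"
    using t by (simp add: power2_eq_square)
  finally show ?thesis
    using in_parallelogram[of s t] s t by fastforce
qed

lemma second_difference_quotient_tendsto:
  fixes f f\<^sub>u f\<^sub>u\<^sub>v :: "'a::real_normed_vector \<Rightarrow> real"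
  assumes "open S" "x \<in> S"
    and f\<^sub>u: "\<And>y. y \<in> S \<Longrightarrow> has_directional_derivative f (f\<^sub>u y) u y"
    and f\<^sub>u\<^sub>v: "\<And>y. y \<in> S \<Longrightarrow> has_directional_derivative f\<^sub>u (f\<^sub>u\<^sub>v y) v y"
    and cont: "isCont f\<^sub>u\<^sub>v x"
  shows "((\<lambda>h. second_difference f (h *\<^sub>R u) (h *\<^sub>R v) x / h\<^sup>2) \<longlongrightarrow> f\<^sub>u\<^sub>v x) (at_right 0)"
proof (rule tendstoI)
  fix e :: real assume "e > 0"
  obtain r where r: "r > 0" "ball x r \<subseteq> S"
    using assms(1,2) openE by blast
  obtain d where d: "d > 0" "\<And>y. dist y x < d \<Longrightarrow> dist (f\<^sub>u\<^sub>v y) (f\<^sub>u\<^sub>v x) < e"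
    using cont \<open>e > 0\<close> unfolding continuous_at_eps_delta by blast
  define \<delta> where "\<delta> = min r d / (norm u + norm v + 1)"
  have "\<delta> > 0"
    using r d by (simp add: \<delta>_def add_nonneg_pos)
  have "dist (second_difference f (h *\<^sub>R u) (h *\<^sub>R v) x / h\<^sup>2) (f\<^sub>u\<^sub>v x) < e"
    if h: "0 < h" "h < \<delta>" for h
  proof -
    have near: "dist y x < min r d" if "y \<in> parallelogram h u v x" for y
    proof -
      have "dist y x \<le> h * (norm u + norm v)"
        using that by (rule dist_parallelogram_le)
      also have "\<dots> < h * (norm u + norm v + 1)"
        using h by simp
      also have "\<dots> < min r d"
        using h by (simp add: \<delta>_def pos_less_divide_eq add_nonneg_pos)
      finally show ?thesis .
    qed
    then have "parallelogram h u v x \<subseteq> S"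
      using r(2) by (force simp: dist_commute)
    then obtain y where "y \<in> parallelogram h u v x"
      "second_difference f (h *\<^sub>R u) (h *\<^sub>R v) x = h\<^sup>2 * f\<^sub>u\<^sub>v y"
      using second_difference_mean_value[of h u v x f f\<^sub>u f\<^sub>u\<^sub>v] f\<^sub>u f\<^sub>u\<^sub>v h(1) by blast
    with near d(2) h show ?thesis
      by simp
  qed
  with \<open>\<delta> > 0\<close> show
    "\<forall>\<^sub>F h in at_right 0. dist (second_difference f (h *\<^sub>R u) (h *\<^sub>R v) x / h\<^sup>2) (f\<^sub>u\<^sub>v x) < e"
    by (intro eventually_at_rightI[of 0 \<delta>]) auto
qed

theorem directional_derivatives_commute:
  fixes f f\<^sub>u f\<^sub>v f\<^sub>u\<^sub>v f\<^sub>v\<^sub>u :: "'a::real_normed_vector \<Rightarrow> real"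
  assumes "open S" "x \<in> S"
    and "\<And>y. y \<in> S \<Longrightarrow> has_directional_derivative f (f\<^sub>u y) u y"
    and "\<And>y. y \<in> S \<Longrightarrow> has_directional_derivative f (f\<^sub>v y) v y"
    and "\<And>y. y \<in> S \<Longrightarrow> has_directional_derivative f\<^sub>u (f\<^sub>u\<^sub>v y) v y"
    and "\<And>y. y \<in> S \<Longrightarrow> has_directional_derivative f\<^sub>v (f\<^sub>v\<^sub>u y) u y"
    and "isCont f\<^sub>u\<^sub>v x" "isCont f\<^sub>v\<^sub>u x"
  shows "f\<^sub>u\<^sub>v x = f\<^sub>v\<^sub>u x"
proof (rule tendsto_unique[OF trivial_limit_at_right_real])
  let ?q = "\<lambda>h. second_difference f (h *\<^sub>R u) (h *\<^sub>R v) x / h\<^sup>2"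
  show "(?q \<longlongrightarrow> f\<^sub>u\<^sub>v x) (at_right 0)"
    using assms by (intro second_difference_quotient_tendsto[of S x f f\<^sub>u])
  have "((\<lambda>h. second_difference f (h *\<^sub>R v) (h *\<^sub>R u) x / h\<^sup>2) \<longlongrightarrow> f\<^sub>v\<^sub>u x) (at_right 0)"
    using assms by (intro second_difference_quotient_tendsto[of S x f f\<^sub>v])
  then show "(?q \<longlongrightarrow> f\<^sub>v\<^sub>u x) (at_right 0)"
    by (simp only: second_difference_commute)
qed

lemma has_derivative_imp_has_directional_derivative:
  assumes "(f has_derivative D) (at x)"
  shows "has_directional_derivative f (D u) u x"
proof -
  have "((\<lambda>s. x + s *\<^sub>R u) has_derivative (\<lambda>h. h *\<^sub>R u)) (at 0)"
    by (auto intro!: derivative_eq_intros)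
  then have "((\<lambda>s. f (x + s *\<^sub>R u)) has_derivative (\<lambda>h. D (h *\<^sub>R u))) (at 0)"
    by (rule has_derivative_compose) (simp add: assms)
  moreover have "linear D"
    using assms by (rule has_derivative_linear)
  ultimately show ?thesis
    by (simp add: has_directional_derivative_def has_field_derivative_def linear_cmul
        mult_commute_abs)
qed

lemma has_directional_derivative_partial:
  "f differentiable (at x) \<Longrightarrow> has_directional_derivative f (partial i f x) (axis i 1) x"
  unfolding partial_def
  by (intro has_derivative_imp_has_directional_derivative) (simp flip: frechet_derivative_works)

lemma smooth_partial: "smooth f \<Longrightarrow> smooth (partial i f)"
  unfolding smooth_def by (metis C_k.simps(2))

lemma smooth_imp_differentiable: "smooth f \<Longrightarrow> f differentiable (at x)"
  unfolding smooth_def by (metis C_k.simps(2))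

lemma smooth_imp_continuous_on: "smooth f \<Longrightarrow> continuous_on S f"
  unfolding smooth_def by (metis C_k.simps(1) continuous_on_subset subset_UNIV)

lemma partial_commute:
  assumes "smooth f"
  shows "partial i (partial j f) = partial j (partial i f)"
proof
  fix x
  have "isCont (partial k (partial l f)) x" for k l
    using smooth_imp_continuous_on[OF smooth_partial[OF smooth_partial[OF assms]], of UNIV]
    by (simp add: continuous_on_eq_continuous_at)
  then show "partial i (partial j f) x = partial j (partial i f) x"
    by (intro directional_derivatives_commute[where S = UNIV and f = f and f\<^sub>u = "partial j f"
          and f\<^sub>v = "partial i f" and u = "axis j 1" and v = "axis i 1"]
        has_directional_derivative_partial smooth_imp_differentiable smooth_partial assms) auto
qed

lemma curl_gradient: "smooth f \<Longrightarrow> curl (gradient f) x = 0"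
  by (simp add: curl_def gradient_def partial_commute[of f 2 3] partial_commute[of f 3 1]
      partial_commute[of f 1 2] vec_eq_iff forall_3)

lemma partial_eq_0_on_open:
  assumes "open S" "x \<in> S" "\<And>y. y \<in> S \<Longrightarrow> f y = 0"
  shows "partial i f x = 0"
proof -
  have "frechet_derivative f (at x) = frechet_derivative (\<lambda>_. 0) (at x)"
    using assms by (intro frechet_derivative_transform_within_open[symmetric]) auto
  then show ?thesis
    by (simp add: partial_def)
qed

lemma test_functions_partial:
  assumes "\<phi> \<in> test_functions \<Omega>"
  shows "partial i \<phi> \<in> test_functions \<Omega>"
proof -
  have "partial i \<phi> x = 0" if "x \<notin> closure {x. \<phi> x \<noteq> 0}" for x
    using that closure_subset[of "{x. \<phi> x \<noteq> 0}"]
    by (intro partial_eq_0_on_open[of "- closure {x. \<phi> x \<noteq> 0}"]) auto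
  then have "closure {x. partial i \<phi> x \<noteq> 0} \<subseteq> closure {x. \<phi> x \<noteq> 0}"
    by (intro closure_minimal) auto
  with assms show ?thesis
    unfolding test_functions_def
    by (auto intro: smooth_partial bounded_subset simp: compact_eq_bounded_closed)
qed

text \<open>
  A function in \<^term>\<open>smooth_away \<gamma> \<Omega>\<close> may be nonzero outside the closure of \<open>\<Omega>\<close>, so at points of
  the frontier its partial derivatives are computed as limits from inside \<open>\<Omega>\<close>.
\<close>

lemma smooth_away_partial:
  assumes "open \<Omega>" "u \<in> smooth_away \<gamma> \<Omega>"
  shows "partial i u \<in> smooth_away \<gamma> \<Omega>"
proof -
  let ?S = "closure {x \<in> closure \<Omega>. u x \<noteq> 0}"
  have smooth: "smooth (partial i u)"
    using assms by (simp add: smooth_away_def smooth_partial)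
  have inside: "partial i u x = 0" if "x \<in> \<Omega> - ?S" for x
    using assms(1) that closure_subset[of "{x \<in> closure \<Omega>. u x \<noteq> 0}"] closure_subset[of \<Omega>]
    by (intro partial_eq_0_on_open[of "\<Omega> - ?S"]) auto
  have "partial i u x = 0" if "x \<in> closure \<Omega>" "x \<notin> ?S" for x
  proof -
    have "x \<in> closure (\<Omega> - ?S)"
      using open_Int_closure_subset[of "- ?S" \<Omega>] that by (auto simp: Diff_eq Int_commute)
    then show ?thesis
      using continuous_constant_on_closure[of "\<Omega> - ?S" "partial i u" 0 x] inside
        smooth_imp_continuous_on[OF smooth] by blast
  qed
  then have "closure {x \<in> closure \<Omega>. partial i u x \<noteq> 0} \<subseteq> ?S"
    by (intro closure_minimal) auto
  with assms(2) smooth show ?thesis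
    unfolding smooth_away_def by blast
qed

lemma gradient_in_smooth_fields_away:
  "\<lbrakk>open \<Omega>; u \<in> smooth_away \<gamma> \<Omega>\<rbrakk> \<Longrightarrow> gradient u \<in> smooth_fields_away \<gamma> \<Omega>"
  by (simp add: smooth_fields_away_def gradient_def smooth_away_partial)

lemma L2_zero: "(\<lambda>x. 0) \<in> L2 \<Omega>"
  by (simp add: L2_def)

lemma L2_inner_integrable:
  assumes "f \<in> L2 \<Omega>" "g \<in> L2 \<Omega>"
  shows "integrable (lebesgue_on \<Omega>) (\<lambda>x. f x \<bullet> g x)"
proof -
  have meas: "f \<in> borel_measurable (lebesgue_on \<Omega>)" "g \<in> borel_measurable (lebesgue_on \<Omega>)"
    and int: "integrable (lebesgue_on \<Omega>) (\<lambda>x. (norm (f x))\<^sup>2 + (norm (g x))\<^sup>2)"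
    using assms by (auto simp: L2_def)
  have "\<bar>f x \<bullet> g x\<bar> \<le> (norm (f x))\<^sup>2 + (norm (g x))\<^sup>2" for x
  proof -
    have "\<bar>f x \<bullet> g x\<bar> \<le> norm (f x) * norm (g x)"
      by (rule Cauchy_Schwarz_ineq2)
    also have "\<dots> \<le> 2 * norm (f x) * norm (g x)"
      by simp
    also have "\<dots> \<le> (norm (f x))\<^sup>2 + (norm (g x))\<^sup>2"
      by (rule sum_squares_bound)
    finally show ?thesis .
  qed
  then show ?thesis
    using meas by (intro Bochner_Integration.integrable_bound[OF int]) auto
qed

lemma L2_diff:
  assumes "f \<in> L2 \<Omega>" "g \<in> L2 \<Omega>"
  shows "(\<lambda>x. f x - g x) \<in> L2 \<Omega>"
proof -
  have "(norm (f x - g x))\<^sup>2 = (norm (f x))\<^sup>2 + (norm (g x))\<^sup>2 - 2 * (f x \<bullet> g x)" for x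
    by (simp add: dot_norm_neg field_simps)
  then show ?thesis
    using assms L2_inner_integrable[OF assms] by (auto simp: L2_def)
qed

lemma L2_vec_nth:
  fixes f :: "real^3 \<Rightarrow> 'b::euclidean_space^'n"
  assumes "f \<in> L2 \<Omega>"
  shows "(\<lambda>x. f x $ i) \<in> L2 \<Omega>"
proof -
  have meas: "f \<in> borel_measurable (lebesgue_on \<Omega>)"
    and int: "integrable (lebesgue_on \<Omega>) (\<lambda>x. (norm (f x))\<^sup>2)"
    using assms by (auto simp: L2_def)
  have meas_nth: "(\<lambda>x. f x $ i) \<in> borel_measurable (lebesgue_on \<Omega>)"
    by (intro borel_measurable_continuous_on[OF _ meas] continuous_intros)
  then have "integrable (lebesgue_on \<Omega>) (\<lambda>x. (norm (f x $ i))\<^sup>2)"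
    by (intro Bochner_Integration.integrable_bound[OF int])
      (auto intro!: power_mono Finite_Cartesian_Product.norm_nth_le)
  with meas_nth show ?thesis
    by (simp add: L2_def)
qed

lemma L2_norm_vec_nth_le:
  fixes f :: "real^3 \<Rightarrow> 'b::euclidean_space^'n"
  assumes "f \<in> L2 \<Omega>"
  shows "L2_norm \<Omega> (\<lambda>x. f x $ i) \<le> L2_norm \<Omega> f"
  using assms L2_vec_nth[OF assms, of i]
  unfolding L2_norm_def L2_def
  by (auto intro!: integral_mono power_mono Finite_Cartesian_Product.norm_nth_le)

lemma L2_norm_nonneg: "0 \<le> L2_norm \<Omega> f"
  by (simp add: L2_norm_def)

lemma L2_continuous_compact_support:
  assumes "\<Omega> \<in> sets lebesgue" "continuous_on UNIV f" "compact K"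
    and "\<And>x. x \<in> \<Omega> - K \<Longrightarrow> f x = 0"
  shows "f \<in> L2 \<Omega>"
proof -
  have meas: "f \<in> borel_measurable (lebesgue_on \<Omega>)"
    using assms by (intro continuous_imp_measurable_on_sets_lebesgue)
      (auto intro: continuous_on_subset)
  have "bounded (f ` K)"
    using assms
    by (intro compact_imp_bounded compact_continuous_image) (auto intro: continuous_on_subset)
  then obtain B where B: "\<And>x. x \<in> K \<Longrightarrow> norm (f x) \<le> B"
    unfolding bounded_iff by blast
  have lmeas: "\<Omega> \<inter> K \<in> lmeasurable"
    using fmeasurable_Int_fmeasurable[OF lmeasurable_compact[OF assms(3)] assms(1)]
    by (simp add: Int_commute)
  then have "\<Omega> \<inter> K \<in> sets (lebesgue_on \<Omega>)"
    using assms(1) by (simp add: sets_restrict_space_iff fmeasurableD)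
  moreover have "emeasure (lebesgue_on \<Omega>) (\<Omega> \<inter> K) < \<infinity>"
    using lmeas assms(1) by (simp add: fmeasurable_def emeasure_restrict_space del: emeasure_completion)
  moreover have "AE x in lebesgue_on \<Omega>. x \<in> \<Omega> \<inter> K \<longrightarrow> norm ((norm (f x))\<^sup>2) \<le> B\<^sup>2"
    by (auto intro!: AE_I2 power_mono B)
  moreover have "AE x in lebesgue_on \<Omega>. x \<notin> \<Omega> \<inter> K \<longrightarrow> (norm (f x))\<^sup>2 = 0"
    using assms by (auto intro!: AE_I2)
  ultimately have "integrable (lebesgue_on \<Omega>) (\<lambda>x. (norm (f x))\<^sup>2)"
    using meas by (intro integrableI_bounded_set[of "\<Omega> \<inter> K" _ _ "B\<^sup>2"]) auto
  with meas show ?thesis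
    by (simp add: L2_def)
qed

lemma test_functions_subset_L2:
  assumes "\<Omega> \<in> sets lebesgue"
  shows "test_functions \<Omega> \<subseteq> L2 \<Omega>"
proof
  fix \<phi> assume "\<phi> \<in> test_functions \<Omega>"
  then show "\<phi> \<in> L2 \<Omega>"
    using assms closure_subset[of "{x. \<phi> x \<noteq> 0}"]
    by (intro L2_continuous_compact_support[of _ _ "closure {x. \<phi> x \<noteq> 0}"])
      (auto simp: test_functions_def smooth_imp_continuous_on)
qed

lemma L2_inner_curl:
  assumes u: "u \<in> L2 \<Omega>" and \<phi>: "\<And>k l. partial k (\<lambda>x. \<phi> x $ l) \<in> L2 \<Omega>"
  defines "I \<equiv> \<lambda>j k l. L2_inner \<Omega> (\<lambda>x. u x $ j) (partial k (\<lambda>x. \<phi> x $ l))"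
  shows "L2_inner \<Omega> u (curl \<phi>) =
    (I 1 2 3 - I 1 3 2) + (I 2 3 1 - I 2 1 3) + (I 3 1 2 - I 3 2 1)"
proof -
  define p where "p k l = partial k (\<lambda>x. \<phi> x $ l)" for k l
  have int: "integrable (lebesgue_on \<Omega>) (\<lambda>x. u x $ j * p k l x)" for j k l
    using L2_inner_integrable[OF L2_vec_nth[OF u] \<phi>] by (simp add: p_def)
  have "u x \<bullet> curl \<phi> x =
      (u x $ 1 * p 2 3 x - u x $ 1 * p 3 2 x) +
      (u x $ 2 * p 3 1 x - u x $ 2 * p 1 3 x) +
      (u x $ 3 * p 1 2 x - u x $ 3 * p 2 1 x)" for x
    by (simp add: curl_def p_def inner_vec_def sum_3 algebra_simps)
  then show ?thesis
    by (simp add: L2_inner_def I_def int flip: p_def)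
qed

lemma weak_Grad_partial_commute:
  assumes "has_weak_Grad \<Omega> v G" "\<phi> \<in> test_functions \<Omega>"
  shows "L2_inner \<Omega> (\<lambda>x. G x $ i $ j) (partial k \<phi>) = L2_inner \<Omega> (\<lambda>x. G x $ i $ k) (partial j \<phi>)"
proof -
  have weak: "L2_inner \<Omega> (\<lambda>x. v x $ i) (partial j (partial k \<phi>)) =
      - L2_inner \<Omega> (\<lambda>x. G x $ i $ j) (partial k \<phi>)" for j k
    using assms(1) test_functions_partial[OF assms(2)] by (simp add: has_weak_Grad_def)
  have "partial j (partial k \<phi>) = partial k (partial j \<phi>)"
    using assms(2) by (intro partial_commute) (simp add: test_functions_def)
  then show ?thesis
    using weak[of j k] weak[of k j] by simp
qed

lemma has_weak_curl_row_of_weak_Grad: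
  assumes "\<Omega> \<in> sets lebesgue" "has_weak_Grad \<Omega> v G"
  shows "has_weak_curl \<Omega> (\<lambda>x. G x $ i) (\<lambda>x. 0)"
  unfolding has_weak_curl_def
proof (intro conjI ballI)
  show row_L2: "(\<lambda>x. G x $ i) \<in> L2 \<Omega>"
    using assms(2) by (simp add: has_weak_Grad_def L2_vec_nth)
  show "(\<lambda>x. 0) \<in> L2 \<Omega>"
    by (rule L2_zero)
  fix \<phi> assume "\<phi> \<in> test_fields \<Omega>"
  then have test: "(\<lambda>x. \<phi> x $ l) \<in> test_functions \<Omega>" for l
    by (simp add: test_fields_def)
  then have "partial k (\<lambda>x. \<phi> x $ l) \<in> L2 \<Omega>" for k l
    using test_functions_partial test_functions_subset_L2[OF assms(1)] by blast
  then have "L2_inner \<Omega> (\<lambda>x. G x $ i) (curl \<phi>) = 0"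
    using weak_Grad_partial_commute[OF assms(2) test, of i 1 2 3]
      weak_Grad_partial_commute[OF assms(2) test, of i 2 3 1]
      weak_Grad_partial_commute[OF assms(2) test, of i 3 1 2]
    by (simp add: L2_inner_curl[OF row_L2])
  then show "L2_inner \<Omega> (\<lambda>x. G x $ i) (curl \<phi>) = L2_inner \<Omega> (\<lambda>x. 0) \<phi>"
    by (simp add: L2_inner_def)
qed

lemma has_weak_Grad_Grad: "v \<in> H_Grad \<Omega> \<Longrightarrow> has_weak_Grad \<Omega> v (Grad \<Omega> v)"
  using someI_ex[of "has_weak_Grad \<Omega> v"] by (simp add: H_Grad_def Grad_def)

lemma H_curl0_bc_gradient_limitI:
  assumes "open \<Omega>" "has_weak_curl \<Omega> w (\<lambda>x. 0)"
    and approx: "\<And>\<epsilon>. \<epsilon> > 0 \<Longrightarrow> \<exists>u \<in> smooth_away \<gamma> \<Omega>. L2_norm \<Omega> (\<lambda>x. w x - gradient u x) < \<epsilon>"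
  shows "w \<in> H_curl0_bc \<gamma> \<Omega>"
proof -
  have "\<exists>\<psi> \<in> smooth_fields_away \<gamma> \<Omega>.
      sqrt ((L2_norm \<Omega> (\<lambda>x. w x - \<psi> x))\<^sup>2 + (L2_norm \<Omega> (\<lambda>x. 0 - curl \<psi> x))\<^sup>2) < \<epsilon>"
    if "\<epsilon> > 0" for \<epsilon>
  proof -
    obtain u where u: "u \<in> smooth_away \<gamma> \<Omega>" "L2_norm \<Omega> (\<lambda>x. w x - gradient u x) < \<epsilon>"
      using approx[OF \<open>\<epsilon> > 0\<close>] by blast
    then have "L2_norm \<Omega> (\<lambda>x. 0 - curl (gradient u) x) = 0"
      by (simp add: smooth_away_def curl_gradient L2_norm_def)
    with u show ?thesis
      by (intro bexI[of _ "gradient u"] gradient_in_smooth_fields_away assms(1))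
        (simp_all add: L2_norm_nonneg)
  qed
  with assms(2) show ?thesis
    unfolding H_curl0_bc_def H_curl_bc_def by blast
qed

lemma Jacobian_in_L2:
  assumes "open \<Omega>" "bounded \<Omega>" "\<And>i. smooth (\<lambda>x. \<phi> x $ i)"
  shows "Jacobian \<phi> \<in> L2 \<Omega>"
proof (rule L2_continuous_compact_support)
  show "continuous_on UNIV (Jacobian \<phi>)"
    unfolding Jacobian_def gradient_def
    by (intro continuous_on_vec_lambda smooth_imp_continuous_on smooth_partial assms(3))
  show "\<Omega> \<in> sets lebesgue" "compact (closure \<Omega>)"
    using assms by auto
  show "Jacobian \<phi> x = 0" if "x \<in> \<Omega> - closure \<Omega>" for x
    using that closure_subset by blast
qed

lemma Grad_in_H_Curl0_bc:
  assumes "open \<Omega>" "bounded \<Omega>" and v: "v \<in> H_Grad_bc \<gamma> \<Omega>"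
  shows "Grad \<Omega> v \<in> H_Curl0_bc \<gamma> \<Omega>"
proof -
  have weak: "has_weak_Grad \<Omega> v (Grad \<Omega> v)"
    using v by (simp add: H_Grad_bc_def has_weak_Grad_Grad)
  have "(\<lambda>x. Grad \<Omega> v x $ i) \<in> H_curl0_bc \<gamma> \<Omega>" for i
  proof (rule H_curl0_bc_gradient_limitI)
    show "has_weak_curl \<Omega> (\<lambda>x. Grad \<Omega> v x $ i) (\<lambda>x. 0)"
      using \<open>open \<Omega>\<close> weak by (intro has_weak_curl_row_of_weak_Grad) auto
    fix \<epsilon> :: real assume "\<epsilon> > 0"
    then obtain \<phi> where \<phi>: "\<phi> \<in> smooth_fields_away \<gamma> \<Omega>"
      and less: "sqrt ((L2_norm \<Omega> (\<lambda>x. v x - \<phi> x))\<^sup>2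
        + (L2_norm \<Omega> (\<lambda>x. Grad \<Omega> v x - Jacobian \<phi> x))\<^sup>2) < \<epsilon>"
      using v unfolding H_Grad_bc_def by blast
    then have "Jacobian \<phi> \<in> L2 \<Omega>"
      using assms(1,2)
      by (intro Jacobian_in_L2) (simp_all add: smooth_fields_away_def smooth_away_def)
    then have "(\<lambda>x. Grad \<Omega> v x - Jacobian \<phi> x) \<in> L2 \<Omega>"
      using weak by (simp add: has_weak_Grad_def L2_diff)
    from L2_norm_vec_nth_le[OF this, of i]
    have "L2_norm \<Omega> (\<lambda>x. Grad \<Omega> v x $ i - gradient (\<lambda>y. \<phi> y $ i) x)
        \<le> L2_norm \<Omega> (\<lambda>x. Grad \<Omega> v x - Jacobian \<phi> x)"
      by (simp add: Jacobian_def)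
    also have "\<dots> < \<epsilon>"
      using real_sqrt_sum_squares_ge2 less by (rule le_less_trans)
    finally show "\<exists>u \<in> smooth_away \<gamma> \<Omega>. L2_norm \<Omega> (\<lambda>x. Grad \<Omega> v x $ i - gradient u x) < \<epsilon>"
      using \<phi> by (auto simp: smooth_fields_away_def)
  qed (rule \<open>open \<Omega>\<close>)
  then show ?thesis
    by (simp add: H_Curl0_bc_def)
qed

lemma irrotational_korn_constant_mono:
  assumes "irrotational_korn_constant \<gamma> \<Omega> c" "c \<le> c'"
  shows "irrotational_korn_constant \<gamma> \<Omega> c'"
proof -
  have "c * L2_norm \<Omega> (\<lambda>x. sym_part (T x)) \<le> c' * L2_norm \<Omega> (\<lambda>x. sym_part (T x))" for T
    using assms(2) by (rule mult_right_mono) (rule L2_norm_nonneg)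
  with assms show ?thesis
    unfolding irrotational_korn_constant_def by (meson less_le_trans order_trans)
qed

theorem corollary16:
  fixes \<Omega> \<Gamma> \<Gamma>\<^sub>t \<Gamma>\<^sub>n :: "(real^3) set" and c\<^sub>m c\<^sub>k c_hat :: real
  assumes "is_domain \<Omega>" and "bounded \<Omega>" and "sliceable \<Gamma>\<^sub>t \<Omega>"
    and "\<Gamma> = frontier \<Omega>" and "lipschitz_boundary \<Omega>"
    and "\<Gamma>\<^sub>t \<noteq> {}" and "openin (top_of_set \<Gamma>) \<Gamma>\<^sub>t"
    and "\<Gamma>\<^sub>n = \<Gamma> - closure \<Gamma>\<^sub>t" and "separated_by_lipschitz_curve \<Gamma> \<Gamma>\<^sub>t \<Gamma>\<^sub>n"
    and "maxwell_constant \<Gamma>\<^sub>t \<Gamma>\<^sub>n \<Omega> c\<^sub>m"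
    and "irrotational_korn_constant \<Gamma>\<^sub>t \<Omega> c\<^sub>k"
    and "c_hat = max (sqrt 2 * c\<^sub>k) (c\<^sub>m * sqrt (1 + 2 * c\<^sub>k\<^sup>2))"
  shows "(\<forall>T \<in> H_Curl0_bc \<Gamma>\<^sub>t \<Omega>.
            L2_norm \<Omega> T \<le> c_hat * L2_norm \<Omega> (\<lambda>x. sym_part (T x))) \<and>
         (\<forall>v \<in> H_Grad \<Omega>. Grad \<Omega> v \<in> H_Curl0_bc \<Gamma>\<^sub>t \<Omega> \<longrightarrow>
            L2_norm \<Omega> (Grad \<Omega> v) \<le> c_hat * L2_norm \<Omega> (\<lambda>x. sym_part (Grad \<Omega> v x))) \<and>
         (\<forall>v \<in> H_Grad_bc \<Gamma>\<^sub>t \<Omega>.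
            L2_norm \<Omega> (Grad \<Omega> v) \<le> c_hat * L2_norm \<Omega> (\<lambda>x. sym_part (Grad \<Omega> v x)))"
proof -
  have "c\<^sub>k > 0"
    using assms by (simp add: irrotational_korn_constant_def)
  then have "c\<^sub>k \<le> sqrt 2 * c\<^sub>k"
    by simp
  then have "c\<^sub>k \<le> c_hat"
    using assms by simp
  with assms have "irrotational_korn_constant \<Gamma>\<^sub>t \<Omega> c_hat"
    by (blast intro: irrotational_korn_constant_mono)
  then have korn: "L2_norm \<Omega> T \<le> c_hat * L2_norm \<Omega> (\<lambda>x. sym_part (T x))"
    if "T \<in> H_Curl0_bc \<Gamma>\<^sub>t \<Omega>" for T
    using that by (simp add: irrotational_korn_constant_def)
  have "Grad \<Omega> v \<in> H_Curl0_bc \<Gamma>\<^sub>t \<Omega>" if "v \<in> H_Grad_bc \<Gamma>\<^sub>t \<Omega>" for v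
    using assms that by (intro Grad_in_H_Curl0_bc) (simp_all add: is_domain_def)
  with korn show ?thesis
    by blast
qed

end
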